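(* Let $0<r\le 1$ and let $\mathcal{F}$ be a family of (not necessarily convex) $r$-fat sets in the plane $\mathbb{R}^2$ whose union is compact, and suppose that $\mathcal{F}$ satisfies the $(2,2)$ property. Then: (1) If $\sqrt{8}-2\le r\le 1$ then $\tau(\mathcal{F})\le 4$. (2) If $0.68\le r\le 1$ then $\tau(\mathcal{F})\le 5$. (3) For every $0<r\le 1$ we have $\tau(\mathcal{F})\le \left(\left\lceil \frac{\sqrt{2}}{r}\right\rceil\right)^2$, and in particular, if $r\ge 0.5$ then $\tau(\mathcal{F})\le 9$.
   Context: $B(c,\rho)\subset\mathbb{R}^2$ denotes the (closed) disk of radius $\rho$ with center $c$. For $0<r\le 1$, a set $S\subset\mathbb{R}^2$ is called $r$-fat if there is a point $c\in S$ such that $B(c,r)\subseteq S\subseteq B(c,1)$. A family $\mathcal{F}$ of sets satisfies the $(p,q)$ property if among any $p$ members of $\mathcal{F}$ there are $q$ members with non-empty intersection; in particular the $(2,2)$ property says that every two members of $\mathcal{F}$ intersect. The piercing number $\tau(\mathcal{F})$ is the minimum size of a set of points in $\mathbb{R}^2$ that intersects every member of $\mathcal{F}$. *)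

theory Defs
  imports "HOL-Analysis.Analysis" "HOL-Library.Extended_Nat"
begin

type_synonym plane = "real^2"

definition r_fat :: "real \<Rightarrow> plane set \<Rightarrow> bool" where
  "r_fat r S \<longleftrightarrow> (\<exists>c\<in>S. cball c r \<subseteq> S \<and> S \<subseteq> cball c 1)"

definition pq_property :: "nat \<Rightarrow> nat \<Rightarrow> 'a set set \<Rightarrow> bool" where
  "pq_property p q \<F> \<longleftrightarrow>
     (\<forall>\<G>. \<G> \<subseteq> \<F> \<and> finite \<G> \<and> card \<G> = p \<longrightarrow>
        (\<exists>\<H>. \<H> \<subseteq> \<G> \<and> card \<H> = q \<and> \<Inter>\<H> \<noteq> {}))"

definition pierces :: "'a set \<Rightarrow> 'a set set \<Rightarrow> bool" where
  "pierces P \<F> \<longleftrightarrow> (\<forall>S\<in>\<F>. P \<inter> S \<noteq> {})"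

text \<open>The infimum of the empty set in \<^typ>\<open>enat\<close> is \<^term>\<open>\<infinity>\<close>, so a family without a finite
  piercing set has piercing number \<^term>\<open>\<infinity>\<close>; otherwise the infimum is attained.\<close>

definition piercing_number :: "'a set set \<Rightarrow> enat" where
  "piercing_number \<F> = (INF P \<in> {P. finite P \<and> pierces P \<F>}. enat (card P))"

end

theory Submission
  imports Defs
begin

text \<open>Two members of the family meet, so their centers are at distance at most 2, and all centers lie
  in an axis-parallel square of side 2. A disk of radius \<open>r\<close> around a piercing point catches every
  member whose center it contains, so it suffices to cover this square by rectangles of diagonal at
  most \<open>2r\<close>. Cutting the square into \<open>n \<times> n\<close> equal squares with \<open>n \<ge> \<surd>2/r\<close> gives the general bound;
  already \<open>n = 2\<close> works for \<open>r \<ge> \<surd>8 - 2\<close>, since \<open>\<surd>8 - 2 > 1/\<surd>2\<close>. For five points, cut the square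
  into a strip of height 0.9, halved, and a strip of height 1.1, divided into three.\<close>

lemma pq_property_2_2_inter:
  assumes "pq_property 2 2 \<F>" "S \<in> \<F>" "T \<in> \<F>" "S \<noteq> T"
  shows "S \<inter> T \<noteq> {}"
proof -
  have "{S, T} \<subseteq> \<F> \<and> finite {S, T} \<and> card {S, T} = 2"
    using assms by auto
  then obtain \<H> where \<H>: "\<H> \<subseteq> {S, T}" "card \<H> = 2" "\<Inter>\<H> \<noteq> {}"
    using assms(1) unfolding pq_property_def by metis
  have "\<H> = {S, T}"
    using \<H> assms(4) by (intro card_subset_eq) auto
  with \<H> show ?thesis by simp
qed

lemma r_fat_centers:
  assumes "\<forall>S\<in>\<F>. r_fat r S" "pq_property 2 2 \<F>"
  obtains c where "\<And>S. S \<in> \<F> \<Longrightarrow> cball (c S) r \<subseteq> S"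
    and "\<And>S T. S \<in> \<F> \<Longrightarrow> T \<in> \<F> \<Longrightarrow> dist (c S) (c T) \<le> 2"
proof -
  have "\<forall>S\<in>\<F>. \<exists>c. cball c r \<subseteq> S \<and> S \<subseteq> cball c 1"
    using assms(1) unfolding r_fat_def by blast
  then obtain c where c: "\<forall>S\<in>\<F>. cball (c S) r \<subseteq> S \<and> S \<subseteq> cball (c S) 1"
    by metis
  have "dist (c S) (c T) \<le> 2" if "S \<in> \<F>" "T \<in> \<F>" for S T
  \<comment> \<open>The (2,2) property speaks of subfamilies with two distinct members, so the
    diagonal case is split off. Otherwise a common point lies within 1 of both centers.\<close>
  proof (cases "S = T")
    case False
    then obtain x where "x \<in> S" "x \<in> T"
      using pq_property_2_2_inter[OF assms(2) \<open>S \<in> \<F>\<close> \<open>T \<in> \<F>\<close>] by blast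
    then have "x \<in> cball (c S) 1" "x \<in> cball (c T) 1"
      using c that by blast+
    then show ?thesis
      using dist_triangle2[of "c S" "c T" x] by simp
  qed simp
  with c that show ?thesis by blast
qed

text \<open>The infimum of \<open>f\<close> over \<open>A\<close> serves as \<open>a\<close>; the
  oscillation bound is also what makes \<open>f\<close> bounded below. For empty \<open>A\<close>
  the claim is vacuous, whatever value the infimum takes.\<close>

lemma bounded_oscillation_interval:
  fixes f :: "'a \<Rightarrow> real"
  assumes "\<And>s t. s \<in> A \<Longrightarrow> t \<in> A \<Longrightarrow> f s - f t \<le> d"
  obtains a where "\<And>s. s \<in> A \<Longrightarrow> a \<le> f s \<and> f s \<le> a + d"
proof
  fix s assume s: "s \<in> A"
  have "bdd_below (f ` A)"
    using assms[OF s] by (intro bdd_belowI2[of _ "f s - d"]) (simp add: algebra_simps)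
  moreover have "f s - d \<le> (INF t\<in>A. f t)"
    using s assms[OF s] by (intro cINF_greatest) (auto simp: algebra_simps)
  ultimately show "(INF t\<in>A. f t) \<le> f s \<and> f s \<le> (INF t\<in>A. f t) + d"
    using s by (auto intro: cINF_lower)
qed

text \<open>The points are the midpoints of \<open>n\<close> consecutive intervals of length
  \<open>2 * h\<close> starting at \<open>a\<close>. The induction splits off the last interval,
  whose midpoint has index \<open>n\<close> because counting starts at 0.\<close>

lemma interval_cover_midpoints:
  fixes x a h :: real
  assumes "0 < n" "a \<le> x" "x \<le> a + 2 * real n * h"
  shows "\<exists>i<n. \<bar>x - (a + (2 * real i + 1) * h)\<bar> \<le> h"
  using assms
proof (induction n rule: nat_induct_non_zero)
  case 1
  then show ?case by auto
next
  case (Suc n)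
  show ?case
  proof (cases "x \<le> a + 2 * real n * h")
    case True
    with Suc show ?thesis using less_SucI by blast
  next
    case False
    with Suc.prems show ?thesis
      by (intro exI[of _ n]) (auto simp: algebra_simps abs_le_iff)
  qed
qed

text \<open>Pythagoras for a rectangle with half-sides \<open>h\<close> and \<open>k\<close>: its
  center is within half a diagonal of each of its points.\<close>

lemma dist_real2_le:
  fixes p q :: "real^2"
  assumes "\<bar>p$1 - q$1\<bar> \<le> h" "\<bar>p$2 - q$2\<bar> \<le> k" "h\<^sup>2 + k\<^sup>2 \<le> r\<^sup>2" "0 \<le> r"
  shows "dist p q \<le> r"
proof -
  have "(p$1 - q$1)\<^sup>2 \<le> h\<^sup>2" "(p$2 - q$2)\<^sup>2 \<le> k\<^sup>2"
    using assms(1,2) by (metis abs_ge_zero power2_abs power_mono)+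
  then have "(p$1 - q$1)\<^sup>2 + (p$2 - q$2)\<^sup>2 \<le> r\<^sup>2"
    using assms(3) by linarith
  then show ?thesis
    using assms(4) by (simp add: dist_vec_def L2_set_def UNIV_2 dist_real_def real_le_lsqrt)
qed

lemma piercing_number_le:
  assumes "finite P" "card P \<le> n" "\<And>S. S \<in> \<F> \<Longrightarrow> \<exists>p\<in>P. p \<in> S"
  shows "piercing_number \<F> \<le> enat n"
proof -
  have "P \<in> {P. finite P \<and> pierces P \<F>}"
    using assms(1,3) unfolding pierces_def by blast
  then have "piercing_number \<F> \<le> enat (card P)"
    unfolding piercing_number_def by (rule INF_lower)
  also have "\<dots> \<le> enat n"
    using assms(2) by simp
  finally show ?thesis .
qed

text \<open>Cell centers of an \<open>m\<close> by \<open>n\<close> grid with lower left corner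
  \<open>(a, b)\<close>; \<open>h\<close> and \<open>k\<close> are half the side lengths of a
  cell.\<close>

definition box_grid :: "real \<Rightarrow> real \<Rightarrow> real \<Rightarrow> real \<Rightarrow> nat \<Rightarrow> nat \<Rightarrow> plane set" where
  "box_grid a b h k m n =
     (\<lambda>(i, j). vector [a + (2 * real i + 1) * h, b + (2 * real j + 1) * k]) ` ({..<m} \<times> {..<n})"

lemma finite_box_grid: "finite (box_grid a b h k m n)"
  by (simp add: box_grid_def)

lemma card_box_grid_le: "card (box_grid a b h k m n) \<le> m * n"
  unfolding box_grid_def
  using card_image_le[of "{..<m} \<times> {..<n}"] by (simp add: card_cartesian_product)

text \<open>The center of the cell containing \<open>q\<close> is within half a diagonal of
  \<open>q\<close>. The disk is placed around \<open>q\<close> because \<open>q\<close> will be the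
  center of a fat set, which contains that disk.\<close>

lemma box_grid_cover:
  fixes q :: plane
  assumes "0 < m" "a \<le> q$1" "q$1 \<le> a + 2 * real m * h"
    and "0 < n" "b \<le> q$2" "q$2 \<le> b + 2 * real n * k"
    and "h\<^sup>2 + k\<^sup>2 \<le> r\<^sup>2" "0 \<le> r"
  shows "\<exists>p\<in>box_grid a b h k m n. p \<in> cball q r"
proof -
  obtain i where i: "i < m" "\<bar>q$1 - (a + (2 * real i + 1) * h)\<bar> \<le> h"
    using interval_cover_midpoints[OF assms(1-3)] by blast
  obtain j where j: "j < n" "\<bar>q$2 - (b + (2 * real j + 1) * k)\<bar> \<le> k"
    using interval_cover_midpoints[OF assms(4-6)] by blast
  let ?p = "vector [a + (2 * real i + 1) * h, b + (2 * real j + 1) * k] :: plane"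
  have "dist q ?p \<le> r"
    using i j assms(7,8) by (intro dist_real2_le[of _ _ h k]) simp_all
  moreover have "?p \<in> box_grid a b h k m n"
    unfolding box_grid_def using i j by force
  ultimately show ?thesis by auto
qed

text \<open>Projection to an axis does not increase distances, so each coordinate of the centers
  oscillates by at most 2.\<close>

lemma r_fat_center_square:
  assumes "\<forall>S\<in>\<F>. r_fat r S" "pq_property 2 2 \<F>"
  obtains c a b where "\<And>S. S \<in> \<F> \<Longrightarrow> cball (c S) r \<subseteq> S"
    and "\<And>S. S \<in> \<F> \<Longrightarrow> a \<le> c S $ 1 \<and> c S $ 1 \<le> a + 2"
    and "\<And>S. S \<in> \<F> \<Longrightarrow> b \<le> c S $ 2 \<and> c S $ 2 \<le> b + 2"
proof -
  obtain c where c: "\<And>S. S \<in> \<F> \<Longrightarrow> cball (c S) r \<subseteq> S"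
    and d: "\<And>S T. S \<in> \<F> \<Longrightarrow> T \<in> \<F> \<Longrightarrow> dist (c S) (c T) \<le> 2"
    using r_fat_centers[OF assms] by blast
  have coord: "c S $ i - c T $ i \<le> 2" if "S \<in> \<F>" "T \<in> \<F>" for S T i
    using d[OF that] dist_vec_nth_le[of "c S" i "c T"] by (simp add: dist_real_def)
  obtain a where "\<And>S. S \<in> \<F> \<Longrightarrow> a \<le> c S $ 1 \<and> c S $ 1 \<le> a + 2"
    using bounded_oscillation_interval[of \<F> "\<lambda>S. c S $ 1" 2] coord by blast
  moreover obtain b where "\<And>S. S \<in> \<F> \<Longrightarrow> b \<le> c S $ 2 \<and> c S $ 2 \<le> b + 2"
    using bounded_oscillation_interval[of \<F> "\<lambda>S. c S $ 2" 2] coord by blast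
  ultimately show ?thesis using that c by blast
qed

lemma piercing_number_le_square:
  assumes "\<forall>S\<in>\<F>. r_fat r S" "pq_property 2 2 \<F>" "0 < r" "0 < n" "sqrt 2 / r \<le> real n"
  shows "piercing_number \<F> \<le> enat (n\<^sup>2)"
proof -
  obtain c a b where c: "\<And>S. S \<in> \<F> \<Longrightarrow> cball (c S) r \<subseteq> S"
    "\<And>S. S \<in> \<F> \<Longrightarrow> a \<le> c S $ 1 \<and> c S $ 1 \<le> a + 2"
    "\<And>S. S \<in> \<F> \<Longrightarrow> b \<le> c S $ 2 \<and> c S $ 2 \<le> b + 2"
    using r_fat_center_square[OF assms(1,2)] by blast
  \<comment> \<open>Half the side of a cell when side 2 is cut into \<open>n\<close> parts; the
    half-diagonal is then \<open>sqrt 2 / real n\<close>.\<close>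
  let ?h = "1 / real n"
  have "sqrt 2 / real n \<le> r"
    using assms(3-5) by (simp add: field_simps)
  then have "(sqrt 2 / real n)\<^sup>2 \<le> r\<^sup>2"
    by (intro power_mono) auto
  then have h: "?h\<^sup>2 + ?h\<^sup>2 \<le> r\<^sup>2"
    by (simp add: power_divide)
  have "\<exists>p\<in>box_grid a b ?h ?h n n. p \<in> S" if "S \<in> \<F>" for S
  proof -
    have "\<exists>p\<in>box_grid a b ?h ?h n n. p \<in> cball (c S) r"
      using c(2,3)[OF that] assms(3,4) h by (intro box_grid_cover) auto
    with c(1)[OF that] show ?thesis by blast
  qed
  then show ?thesis
    using card_box_grid_le[of a b ?h ?h n n]
    by (intro piercing_number_le[OF finite_box_grid]) (simp_all add: power2_eq_square)
qed

lemma piercing_number_le_5: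
  assumes "\<forall>S\<in>\<F>. r_fat r S" "pq_property 2 2 \<F>" "0.68 \<le> r"
  shows "piercing_number \<F> \<le> 5"
proof -
  obtain c a b where c: "\<And>S. S \<in> \<F> \<Longrightarrow> cball (c S) r \<subseteq> S"
    "\<And>S. S \<in> \<F> \<Longrightarrow> a \<le> c S $ 1 \<and> c S $ 1 \<le> a + 2"
    "\<And>S. S \<in> \<F> \<Longrightarrow> b \<le> c S $ 2 \<and> c S $ 2 \<le> b + 2"
    using r_fat_center_square[OF assms(1,2)] by blast
  \<comment> \<open>Squared half-diagonals: 0.25 + 0.2025 = 0.4525 for the lower cells and 1/9 +
    0.3025 < 0.414 for the upper ones, both below 0.68^2 = 0.4624.\<close>
  let ?P = "box_grid a b (1/2) 0.45 2 1" and ?Q = "box_grid a (b + 0.9) (1/3) 0.55 3 1"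
  have r2: "0.68\<^sup>2 \<le> r\<^sup>2"
    using assms(3) by (intro power_mono) auto
  have "\<exists>p\<in>?P \<union> ?Q. p \<in> S" if "S \<in> \<F>" for S
  proof -
    have "\<exists>p\<in>?P \<union> ?Q. p \<in> cball (c S) r"
    proof (cases "c S $ 2 \<le> b + 0.9")
      case True
      then have "\<exists>p\<in>?P. p \<in> cball (c S) r"
        using c(2,3)[OF that] assms(3) r2
        by (intro box_grid_cover) (auto simp: power2_eq_square)
      then show ?thesis by blast
    next
      case False
      then have "\<exists>p\<in>?Q. p \<in> cball (c S) r"
        using c(2,3)[OF that] assms(3) r2
        by (intro box_grid_cover) (auto simp: power2_eq_square)
      then show ?thesis by blast
    qed
    with c(1)[OF that] show ?thesis by blast
  qed
  moreover have "card (?P \<union> ?Q) \<le> 5"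
    using card_Un_le[of ?P ?Q] card_box_grid_le[of a b "1/2" "0.45" 2 1]
      card_box_grid_le[of a "b + 0.9" "1/3" "0.55" 3 1] by linarith
  ultimately have "piercing_number \<F> \<le> enat 5"
    by (intro piercing_number_le[of "?P \<union> ?Q"]) (simp_all add: finite_box_grid)
  then show ?thesis by (simp add: numeral_eq_enat)
qed

theorem theorem1p8:
  fixes r :: real and \<F> :: "plane set set"
  assumes "0 < r" and "r \<le> 1"
    and "\<forall>S\<in>\<F>. r_fat r S"
    and "compact (\<Union>\<F>)"
    and "pq_property 2 2 \<F>"
  shows "(sqrt 8 - 2 \<le> r \<and> r \<le> 1 \<longrightarrow> piercing_number \<F> \<le> 4) \<and>
         (0.68 \<le> r \<and> r \<le> 1 \<longrightarrow> piercing_number \<F> \<le> 5) \<and>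
         piercing_number \<F> \<le> enat ((nat \<lceil>sqrt 2 / r\<rceil>)\<^sup>2) \<and>
         (0.5 \<le> r \<longrightarrow> piercing_number \<F> \<le> 9)"
proof (intro conjI impI)
  note square = piercing_number_le_square[OF assms(3,5,1)]
  have sqrt2: "sqrt 2 \<le> 1.42" "1.41 \<le> sqrt 2"
    by (rule real_le_lsqrt real_le_rsqrt; simp add: power2_eq_square)+
  show "piercing_number \<F> \<le> 4" if "sqrt 8 - 2 \<le> r \<and> r \<le> 1"
  proof -
    have "sqrt 8 = 2 * sqrt 2"
      using real_sqrt_mult[of 4 2] by simp
    \<comment> \<open>With r \<ge> 2 * sqrt 2 - 2, the bound sqrt 2 \<le> 2 * r reduces to sqrt 2
      \<ge> 4/3.\<close>
    then have "sqrt 2 / r \<le> real 2"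
      using that sqrt2 assms(1) by (simp add: field_simps)
    from square[OF _ this] show ?thesis by (simp add: numeral_eq_enat)
  qed
  show "piercing_number \<F> \<le> 9" if "0.5 \<le> r"
  proof -
    \<comment> \<open>Here 3 * r \<ge> 1.5 > 1.42 \<ge> sqrt 2, so a 3 by 3 grid suffices.\<close>
    have "sqrt 2 / r \<le> real 3"
      using that sqrt2 assms(1) by (simp add: field_simps)
    from square[OF _ this] show ?thesis by (simp add: numeral_eq_enat)
  qed
  show "piercing_number \<F> \<le> 5" if "0.68 \<le> r \<and> r \<le> 1"
    using piercing_number_le_5[OF assms(3,5)] that by simp
  show "piercing_number \<F> \<le> enat ((nat \<lceil>sqrt 2 / r\<rceil>)\<^sup>2)"
    using assms(1) by (intro square) (auto intro: real_nat_ceiling_ge)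
qed

end
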